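(* Let $t\geq 1$ and $\ell\geq 2$ be integers. Then $$pc_{1,\ell}(Q_t)=\begin{cases} 1 & \text{if } t=1,\\ 2 & \text{if } t=2,\\ t & \text{if } t\geq 3 \text{ and } \ell\geq t,\\ \ell+1 & \text{if } t\geq 3 \text{ and } \ell<t.\end{cases}$$
   Context: The $t$-cube $Q_t$ is the graph whose vertices are the ordered $t$-tuples of $0$'s and $1$'s, two vertices being adjacent if and only if the $t$-tuples differ in exactly one coordinate. An edge-coloring of a graph is an arbitrary map from its edge set to the natural numbers (adjacent edges may share a color). In an edge-colored graph, a path $P$ is a distance $\ell$-proper path if no two edges of $P$ of the same color appear with fewer than $\ell$ edges in between on $P$. For a connected graph $G$, $pc_{1,\ell}(G)$ is the minimum number of colors in an edge-coloring of $G$ such that every pair of distinct vertices of $G$ is connected by at least one distance $\ell$-proper path. *)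

theory Defs
  imports Main
begin

text \<open>
  A simple undirected graph is given by its vertex set \<open>V\<close> and its set \<open>E\<close> of edges, each edge
  being the two-element set of its endpoints.
\<close>

definition cube_verts :: "nat \<Rightarrow> nat list set" where
  "cube_verts t = {x. length x = t \<and> set x \<subseteq> {0, 1}}"

definition cube_edges :: "nat \<Rightarrow> nat list set set" where
  "cube_edges t =
     {{x, y} | x y. x \<in> cube_verts t \<and> y \<in> cube_verts t \<and> (\<exists>!i. i < t \<and> x ! i \<noteq> y ! i)}"

definition is_path :: "'a set \<Rightarrow> 'a set set \<Rightarrow> 'a list \<Rightarrow> bool" where
  "is_path V E p \<longleftrightarrow>
     p \<noteq> [] \<and> set p \<subseteq> V \<and> distinct p \<and> (\<forall>i. Suc i < length p \<longrightarrow> {p ! i, p ! Suc i} \<in> E)"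

definition path_edge :: "'a list \<Rightarrow> nat \<Rightarrow> 'a set" where
  "path_edge p i = {p ! i, p ! Suc i}"

text \<open>
  Exactly \<open>j - i - 1\<close> edges of \<open>p\<close> lie strictly between its edges number \<open>i\<close> and \<open>j\<close>, \<open>i < j\<close>.
\<close>

definition distance_proper :: "nat \<Rightarrow> ('a set \<Rightarrow> nat) \<Rightarrow> 'a list \<Rightarrow> bool" where
  "distance_proper l c p \<longleftrightarrow>
     \<not> (\<exists>i j. i < j \<and> Suc j < length p \<and>
           c (path_edge p i) = c (path_edge p j) \<and> j - i - 1 < l)"

definition distance_proper_connected ::
    "'a set \<Rightarrow> 'a set set \<Rightarrow> nat \<Rightarrow> ('a set \<Rightarrow> nat) \<Rightarrow> bool" where
  "distance_proper_connected V E l c \<longleftrightarrow>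
     (\<forall>u\<in>V. \<forall>v\<in>V. u \<noteq> v \<longrightarrow>
        (\<exists>p. is_path V E p \<and> hd p = u \<and> last p = v \<and> distance_proper l c p))"

text \<open>
  The number \<open>pc\<^bsub>1,l\<^esub>\<close>. Only the values of the coloring \<open>c\<close> on \<open>E\<close> matter. The value is meaningful
  when \<open>E\<close> is finite and the graph is connected: then an injective coloring shows that the minimum
  is over a nonempty set. Finiteness of \<open>c ` E\<close> is required because infinite sets have
  cardinality 0.
\<close>

definition pc1 :: "'a set \<Rightarrow> 'a set set \<Rightarrow> nat \<Rightarrow> nat" where
  "pc1 V E l =
     (LEAST k. \<exists>c :: 'a set \<Rightarrow> nat.
        finite (c ` E) \<and> card (c ` E) = k \<and> distance_proper_connected V E l c)"

end

theory Submission
  imports Defs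
begin

text \<open>
  In all four cases the value is \<open>min t (l + 1)\<close>. A path between antipodal vertices has at least
  \<open>t\<close> edges, and its first \<open>min t (l + 1)\<close> edges have pairwise distinct colors. Conversely,
  coloring every edge by the coordinate it changes uses \<open>t\<close> colors and makes geodesics that change
  the coordinates in increasing order proper. Repeating \<open>l + 1\<close> colors cyclically along a
  Hamiltonian path (a Gray code) makes every subpath of that path proper.
\<close>

section \<open>Paths and color counts in arbitrary graphs\<close>

lemma is_path_iff_successively:
  "is_path V E p \<longleftrightarrow>
     p \<noteq> [] \<and> set p \<subseteq> V \<and> distinct p \<and> successively (\<lambda>x y. {x, y} \<in> E) p"
  by (auto simp: is_path_def successively_conv_nth)

lemma is_path_rev: "is_path V E p \<Longrightarrow> is_path V E (rev p)"
  by (simp add: is_path_iff_successively insert_commute)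

lemma path_edge_rev:
  assumes "Suc i < length p"
  shows "path_edge (rev p) i = path_edge p (length p - Suc (Suc i))"
proof -
  have "Suc (length p - Suc (Suc i)) = length p - Suc i" using assms by simp
  then show ?thesis using assms by (auto simp: path_edge_def rev_nth)
qed

text \<open>Reversal keeps the number of edges between two given edges. This serves pairs of
  vertices that a Hamiltonian path meets in the opposite order.\<close>

lemma distance_proper_rev:
  assumes "distance_proper l c p"
  shows "distance_proper l c (rev p)"
  unfolding distance_proper_def
proof (rule notI, elim exE conjE)
  fix i j
  assume ij: "i < j" "Suc j < length (rev p)" "j - i - 1 < l"
    and eq: "c (path_edge (rev p) i) = c (path_edge (rev p) j)"
  let ?f = "\<lambda>i. length p - Suc (Suc i)"
  have "c (path_edge p (?f j)) = c (path_edge p (?f i))"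
    using eq ij by (simp add: path_edge_rev)
  moreover have "?f j < ?f i" "Suc (?f i) < length p" "?f i - ?f j - 1 < l"
    using ij by auto
  ultimately show False using assms unfolding distance_proper_def by blast
qed

lemma path_edge_inj:
  assumes "distinct p" "Suc i < length p" "Suc j < length p" "path_edge p i = path_edge p j"
  shows "i = j"
  using assms by (auto simp: path_edge_def doubleton_eq_iff nth_eq_iff_index_eq)

text \<open>Any two of the first \<open>m\<close> edges have at most \<open>l - 1\<close> edges
  between them, because \<open>m \<le> Suc l\<close>, so their colors differ.\<close>

lemma card_colors_ge:
  assumes fin: "finite (c ` E)" and p: "is_path V E p" "distance_proper l c p"
    and m: "m < length p" "m \<le> Suc l"
  shows "m \<le> card (c ` E)"
proof -
  let ?f = "\<lambda>i. c (path_edge p i)"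
  have ne: "?f i \<noteq> ?f j" if "i < j" "j < m" for i j
  proof -
    have "Suc j < length p" "j - i - 1 < l" using that m by auto
    then show ?thesis using p(2) that(1) unfolding distance_proper_def by blast
  qed
  have "inj_on ?f {..<m}"
    by (rule linorder_inj_onI) (use ne in auto)
  moreover have "?f ` {..<m} \<subseteq> c ` E"
    using p(1) m by (auto simp: is_path_def path_edge_def)
  ultimately show ?thesis
    using card_inj_on_le[OF _ _ fin] by fastforce
qed

text \<open>\<open>pc1\<close> asks for exactly \<open>k\<close> colors, but a coloring with values
  below \<open>k\<close> suffices: the lower bound, applied to that very coloring, shows that all
  \<open>k\<close> values occur.\<close>

lemma pc1_eqI:
  assumes lower: "\<And>c. finite (c ` E) \<Longrightarrow> distance_proper_connected V E l c \<Longrightarrow> k \<le> card (c ` E)"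
    and upper: "distance_proper_connected V E l c" "c ` E \<subseteq> {..<k}"
  shows "pc1 V E l = k"
proof -
  have fin: "finite (c ` E)" using upper(2) finite_subset by blast
  have "card (c ` E) \<le> k" using card_mono[OF _ upper(2)] by simp
  then have "card (c ` E) = k" using lower[OF fin upper(1)] by simp
  then show ?thesis
    unfolding pc1_def using fin upper(1) lower by (intro Least_equality) auto
qed

text \<open>Edge number \<open>i\<close> of the Hamiltonian path \<open>g\<close> gets color
  \<open>i mod Suc l\<close>, so equal colors on \<open>g\<close> sit at least \<open>Suc l\<close>
  positions apart, with at least \<open>l\<close> edges between them. Any two vertices are joined by
  a segment of \<open>g\<close>, read forwards or backwards.\<close>

lemma traceable_distance_proper_connected:
  assumes g: "is_path V E g" "set g = V"
  shows "\<exists>c. distance_proper_connected V E l c \<and> c ` E \<subseteq> {..<Suc l}"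
proof -
  \<comment> \<open>For edges off \<open>g\<close> the value of \<open>pos\<close> is unspecified.
    The connecting paths avoid them, and reduction modulo \<open>Suc l\<close> still bounds their
    colors.\<close>
  define pos where "pos e = (THE i. Suc i < length g \<and> path_edge g i = e)" for e
  define c where "c e = pos e mod Suc l" for e
  have dg: "distinct g" using g by (simp add: is_path_def)
  have pos: "pos (path_edge g i) = i" if "Suc i < length g" for i
    unfolding pos_def
    by (rule the_equality) (use that in \<open>auto intro: path_edge_inj[OF dg]\<close>)
  have sub: "\<exists>p. is_path V E p \<and> hd p = g ! a \<and> last p = g ! b \<and> distance_proper l c p"
    if ab: "a < b" "b < length g" for a b
  proof -
    define p where "p = drop a (take (Suc b) g)"
    have len: "length p = Suc (b - a)" using ab by (simp add: p_def)
    have nth: "p ! i = g ! (a + i)" if "i \<le> b - a" for i using that ab by (simp add: p_def)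
    have edge: "path_edge p i = path_edge g (a + i)" if "Suc i < length p" for i
      using that by (simp add: path_edge_def nth len)
    have "p \<noteq> []" using len by auto
    moreover have "set p \<subseteq> V"
      using g(2) unfolding p_def by (auto dest: in_set_dropD in_set_takeD)
    moreover have "distinct p" using dg by (simp add: p_def)
    moreover have "{p ! i, p ! Suc i} \<in> E" if "Suc i < length p" for i
      using edge[OF that] that ab g(1) by (simp add: path_edge_def is_path_def len)
    ultimately have "is_path V E p" unfolding is_path_def by blast
    moreover have "hd p = g ! a" using \<open>p \<noteq> []\<close> nth[of 0] by (simp add: hd_conv_nth)
    moreover have "last p = g ! b"
      using \<open>p \<noteq> []\<close> nth[of "b - a"] ab by (simp add: last_conv_nth len)
    moreover have "distance_proper l c p"
      unfolding distance_proper_def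
    proof (rule notI, elim exE conjE)
      fix i j
      assume ij: "i < j" "Suc j < length p" "j - i - 1 < l"
        and eq: "c (path_edge p i) = c (path_edge p j)"
      have "(a + i) mod Suc l = (a + j) mod Suc l"
        using eq ij ab len by (simp add: c_def edge pos)
      then have "Suc l dvd (a + j) - (a + i)"
        using ij(1) by (intro mod_eq_dvd_iff_nat[THEN iffD1]) auto
      then have "Suc l \<le> j - i" using ij(1) by (intro dvd_imp_le) auto
      then show False using ij(3) by simp
    qed
    ultimately show ?thesis by blast
  qed
  have "\<exists>p. is_path V E p \<and> hd p = u \<and> last p = v \<and> distance_proper l c p"
    if uv: "u \<in> V" "v \<in> V" "u \<noteq> v" for u v
  proof -
    obtain a b where a: "a < length g" "u = g ! a" and b: "b < length g" "v = g ! b"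
      using uv g(2) by (metis in_set_conv_nth)
    then consider "a < b" | "b < a" using uv(3) by fastforce
    then show ?thesis
    proof cases
      case 1
      then show ?thesis using sub a b by blast
    next
      case 2
      then obtain p where "is_path V E p" "hd p = v" "last p = u" "distance_proper l c p"
        using sub a b by blast
      then have "is_path V E (rev p) \<and> hd (rev p) = u \<and> last (rev p) = v \<and>
          distance_proper l c (rev p)"
        by (simp add: is_path_rev distance_proper_rev hd_rev last_rev)
      then show ?thesis by blast
    qed
  qed
  then have "distance_proper_connected V E l c"
    unfolding distance_proper_connected_def by blast
  moreover have "c ` E \<subseteq> {..<Suc l}" by (auto simp: c_def)
  ultimately show ?thesis by blast
qed

section \<open>Edges of the cube and the length of antipodal paths\<close>

lemma cube_edgesI:
  assumes "x \<in> cube_verts t" "y \<in> cube_verts t" "i < t" "x ! i \<noteq> y ! i"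
    and "\<And>j. j < t \<Longrightarrow> j \<noteq> i \<Longrightarrow> x ! j = y ! j"
  shows "{x, y} \<in> cube_edges t"
  unfolding cube_edges_def using assms by blast

lemma cube_edgesE:
  assumes "e \<in> cube_edges t"
  obtains x y i where "e = {x, y}" "x \<in> cube_verts t" "y \<in> cube_verts t" "i < t"
    "x ! i \<noteq> y ! i" "\<And>j. j < t \<Longrightarrow> j \<noteq> i \<Longrightarrow> x ! j = y ! j"
proof -
  obtain x y where xy: "e = {x, y}" "x \<in> cube_verts t" "y \<in> cube_verts t"
    and ex: "\<exists>!i. i < t \<and> x ! i \<noteq> y ! i"
    using assms unfolding cube_edges_def by blast
  from ex obtain i where "i < t" "x ! i \<noteq> y ! i" by blast
  with xy ex show ?thesis using that by metis
qed

text \<open>Each edge changes one coordinate, so at most \<open>i\<close> coordinates are nonzero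
  after \<open>i\<close> edges, while all \<open>t\<close> are nonzero at the end.\<close>

lemma cube_path_length:
  assumes p: "is_path (cube_verts t) (cube_edges t) p"
    and hd: "hd p = replicate t 0" and last: "last p = replicate t 1"
  shows "t < length p"
proof -
  let ?D = "\<lambda>i. {j. j < t \<and> p ! i ! j \<noteq> 0}"
  have ne: "p \<noteq> []" using p by (simp add: is_path_def)
  have "card (?D i) \<le> i" if "i < length p" for i
    using that
  proof (induction i)
    case 0
    have "?D 0 = {}" using hd ne by (auto simp: hd_conv_nth)
    then show ?case by simp
  next
    case (Suc i)
    have "{p ! i, p ! Suc i} \<in> cube_edges t" using p Suc.prems by (simp add: is_path_def)
    then obtain k where "\<And>j. j < t \<Longrightarrow> j \<noteq> k \<Longrightarrow> p ! i ! j = p ! Suc i ! j"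
      by (elim cube_edgesE) (metis doubleton_eq_iff)
    then have "?D (Suc i) \<subseteq> insert k (?D i)" by auto
    then have "card (?D (Suc i)) \<le> card (insert k (?D i))" by (intro card_mono) auto
    also have "\<dots> \<le> Suc (card (?D i))" by (intro card_insert_le_m1) auto
    finally show ?case using Suc by simp
  qed
  from this[of "length p - 1"] have "card (?D (length p - 1)) \<le> length p - 1"
    using ne by simp
  moreover have "?D (length p - 1) = {..<t}"
    using last ne by (auto simp: last_conv_nth)
  then have "card (?D (length p - 1)) = t" by simp
  moreover have "0 < length p" using ne by simp
  ultimately show ?thesis by linarith
qed

section \<open>Coloring by the changed coordinate\<close>

text \<open>On a cube edge this is the only coordinate that changes; taking the least one determines
  it without reference to \<open>t\<close>.\<close>

definition cube_dir :: "nat list set \<Rightarrow> nat" where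
  "cube_dir e = (LEAST i. \<exists>x\<in>e. \<exists>y\<in>e. x ! i \<noteq> y ! i)"

lemma cube_dir_eq:
  assumes "x ! i \<noteq> y ! i" "\<And>j. j < i \<Longrightarrow> x ! j = y ! j"
  shows "cube_dir {x, y} = i"
  unfolding cube_dir_def
  by (rule Least_equality) (use assms in \<open>auto simp flip: not_less\<close>)

lemma cube_dir_less: "e \<in> cube_edges t \<Longrightarrow> cube_dir e < t"
  by (elim cube_edgesE) (metis cube_dir_eq order.strict_trans less_irrefl)

text \<open>Induction on the number \<open>n\<close> of leading coordinates in which
  \<open>u\<close> and \<open>v\<close> may differ. Two clauses serve the induction: agreement from
  \<open>n\<close> on keeps the next vertex off the path, and the bound on directions makes the next
  direction exceed all earlier ones.\<close>

lemma cube_monotone_path: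
  assumes "n \<le> t" "u \<in> cube_verts t" "v \<in> cube_verts t"
    and "\<And>j. n \<le> j \<Longrightarrow> j < t \<Longrightarrow> u ! j = v ! j"
  shows "\<exists>p. is_path (cube_verts t) (cube_edges t) p \<and> hd p = u \<and> last p = v \<and>
           (\<forall>x\<in>set p. \<forall>j. n \<le> j \<longrightarrow> j < t \<longrightarrow> x ! j = v ! j) \<and>
           (\<forall>i. Suc i < length p \<longrightarrow> cube_dir (path_edge p i) < n) \<and>
           (\<forall>i j. i < j \<longrightarrow> Suc j < length p \<longrightarrow>
              cube_dir (path_edge p i) < cube_dir (path_edge p j))"
  using assms
proof (induction n arbitrary: v)
  case 0
  have "u = v" using 0 by (intro nth_equalityI) (auto simp: cube_verts_def)
  then show ?case using 0 by (intro exI[of _ "[u]"]) (simp add: is_path_def)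
next
  case (Suc n)
  have n: "n < t" using Suc.prems by simp
  \<comment> \<open>Coordinate \<open>n\<close> of \<open>v\<close> is set back to that of
    \<open>u\<close>: the induction hypothesis reaches \<open>w\<close>, and at most one edge, in
    direction \<open>n\<close>, remains.\<close>
  define w where "w = v[n := u ! n]"
  have w: "w \<in> cube_verts t"
    using Suc.prems n set_update_subset_insert[of v n "u ! n"] nth_mem[of n u]
    unfolding cube_verts_def w_def by fastforce
  have wv: "w ! j = v ! j" if "j \<noteq> n" for j using that by (simp add: w_def)
  have wn: "w ! n = u ! n" using n Suc.prems by (simp add: w_def cube_verts_def)
  have uw: "u ! j = w ! j" if "n \<le> j" "j < t" for j
    using that wn wv[of j] Suc.prems(4)[of j] by (cases "j = n") auto
  obtain p where p: "is_path (cube_verts t) (cube_edges t) p" "hd p = u" "last p = w"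
    and agree: "\<And>x j. x \<in> set p \<Longrightarrow> n \<le> j \<Longrightarrow> j < t \<Longrightarrow> x ! j = w ! j"
    and less: "\<And>i. Suc i < length p \<Longrightarrow> cube_dir (path_edge p i) < n"
    and mono: "\<And>i j. i < j \<Longrightarrow> Suc j < length p \<Longrightarrow>
              cube_dir (path_edge p i) < cube_dir (path_edge p j)"
    using Suc.IH[OF _ Suc.prems(2) w uw] n by auto
  show ?case
  proof (cases "u ! n = v ! n")
    case True
    then have "w = v" by (simp add: w_def)
    then show ?thesis
      using p agree less mono by (intro exI[of _ p]) (auto simp: less_SucI)
  next
    case False
    have ne: "p \<noteq> []" using p by (simp add: is_path_def)
    \<comment> \<open>Every vertex of \<open>p\<close> agrees with \<open>w\<close>, hence with
      \<open>u\<close>, in coordinate \<open>n\<close>, and \<open>v\<close> does not.\<close>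
    have "v \<notin> set p" using agree[of v n] wn n False by auto
    moreover have "{w, v} \<in> cube_edges t"
      using wv wn False by (intro cube_edgesI[OF w Suc.prems(3) n]) auto
    ultimately have path: "is_path (cube_verts t) (cube_edges t) (p @ [v])"
      using p ne Suc.prems(3)
      by (auto simp: is_path_iff_successively successively_append_iff)
    have old: "path_edge (p @ [v]) i = path_edge p i" if "Suc i < length p" for i
      using that by (simp add: path_edge_def nth_append)
    have "path_edge (p @ [v]) (length p - 1) = {w, v}"
      using ne p(3) by (simp add: path_edge_def nth_append last_conv_nth)
    moreover have "cube_dir {w, v} = n"
      using wv wn False by (intro cube_dir_eq) auto
    ultimately have new: "cube_dir (path_edge (p @ [v]) i) = n" if "Suc i = length p" for i
      using that by (metis diff_Suc_1)
    have "cube_dir (path_edge (p @ [v]) i) < Suc n" if "Suc i < length (p @ [v])" for i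
      using that less[of i] old[of i] new[of i] by (cases "Suc i = length p") auto
    moreover have "cube_dir (path_edge (p @ [v]) i) < cube_dir (path_edge (p @ [v]) j)"
      if "i < j" "Suc j < length (p @ [v])" for i j
      using that less[of i] mono[of i j] old[of i] old[of j] new[of j]
      by (cases "Suc j = length p") auto
    moreover have "x ! j = v ! j" if "x \<in> set (p @ [v])" "Suc n \<le> j" "j < t" for x j
      using that agree[of x j] wv[of j] by auto
    moreover have "hd (p @ [v]) = u" "last (p @ [v]) = v" using ne p(2) by auto
    ultimately show ?thesis
      using path by (intro exI[of _ "p @ [v]"] conjI) blast+
  qed
qed

text \<open>Strictly increasing directions never repeat a color, so the distance \<open>l\<close> is
  arbitrary.\<close>

lemma cube_dir_connected:
  "distance_proper_connected (cube_verts t) (cube_edges t) l cube_dir"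
  unfolding distance_proper_connected_def
proof (intro ballI impI)
  fix u v assume "u \<in> cube_verts t" "v \<in> cube_verts t"
  then obtain p where "is_path (cube_verts t) (cube_edges t) p" "hd p = u" "last p = v"
    and "\<And>i j. i < j \<Longrightarrow> Suc j < length p \<Longrightarrow>
              cube_dir (path_edge p i) < cube_dir (path_edge p j)"
    using cube_monotone_path[of t t u v] by auto
  then show "\<exists>p. is_path (cube_verts t) (cube_edges t) p \<and> hd p = u \<and> last p = v \<and>
      distance_proper l cube_dir p"
    unfolding distance_proper_def by (metis less_irrefl)
qed

section \<open>A Hamiltonian path of the cube\<close>

text \<open>The reflected binary Gray code: traversing the second copy backwards makes the two
  vertices at the junction differ in the leading coordinate only.\<close>

fun gray :: "nat \<Rightarrow> nat list list" where
  "gray 0 = [[]]"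
| "gray (Suc t) = map ((#) 0) (gray t) @ map ((#) 1) (rev (gray t))"

lemma set_gray: "set (gray t) = cube_verts t"
proof (induction t)
  case 0
  show ?case by (auto simp: cube_verts_def)
next
  case (Suc t)
  have "cube_verts (Suc t) = (#) 0 ` cube_verts t \<union> (#) 1 ` cube_verts t"
    by (auto simp: cube_verts_def length_Suc_conv)
  then show ?case using Suc by simp
qed

lemma cube_edges_Cons:
  assumes "{x, y} \<in> cube_edges t" "a \<in> {0, 1}"
  shows "{a # x, a # y} \<in> cube_edges (Suc t)"
proof -
  obtain x' y' i where e: "{x, y} = {x', y'}" "x' \<in> cube_verts t" "y' \<in> cube_verts t" "i < t"
    "x' ! i \<noteq> y' ! i" and eq: "\<And>j. j < t \<Longrightarrow> j \<noteq> i \<Longrightarrow> x' ! j = y' ! j"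
    using assms(1) by (rule cube_edgesE) (rule that)
  have "{a # x', a # y'} \<in> cube_edges (Suc t)"
  proof (rule cube_edgesI[where i = "Suc i"])
    show "(a # x') ! j = (a # y') ! j" if "j < Suc t" "j \<noteq> Suc i" for j
      using that eq by (cases j) auto
  qed (use e assms(2) in \<open>auto simp: cube_verts_def\<close>)
  \<comment> \<open>Only the unordered pairs are known to be equal; taking images under
    \<open>(#) a\<close> avoids matching up their endpoints.\<close>
  moreover have "{a # x, a # y} = {a # x', a # y'}"
    using arg_cong[OF e(1), of "image ((#) a)"] by simp
  ultimately show ?thesis by metis
qed

text \<open>Both halves inherit adjacency from \<open>gray t\<close>, their different heads keep
  them disjoint, and the junction is a single edge in direction 0.\<close>

lemma is_path_gray: "is_path (cube_verts t) (cube_edges t) (gray t)"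
proof (induction t)
  case 0
  show ?case by (simp add: is_path_def cube_verts_def)
next
  case (Suc t)
  let ?E = "\<lambda>t x y. {x, y} \<in> cube_edges t"
  have g: "gray t \<noteq> []" "distinct (gray t)" "successively (?E t) (gray t)"
    using Suc by (auto simp: is_path_iff_successively)
  then have "successively (?E t) (rev (gray t))" by (simp add: insert_commute)
  then have "successively (?E (Suc t)) (map ((#) 0) (gray t))"
    "successively (?E (Suc t)) (map ((#) 1) (rev (gray t)))"
    unfolding successively_map using g(3)
    by (auto elim!: successively_mono intro!: cube_edges_Cons simp: insert_commute)
  moreover have "?E (Suc t) (0 # last (gray t)) (1 # last (gray t))"
  proof (rule cube_edgesI[where i = 0])
    have "last (gray t) \<in> cube_verts t" using g(1) set_gray last_in_set by blast
    then show "0 # last (gray t) \<in> cube_verts (Suc t)" "1 # last (gray t) \<in> cube_verts (Suc t)"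
      by (auto simp: cube_verts_def)
  qed (auto simp: nth_Cons')
  ultimately have "successively (?E (Suc t)) (gray (Suc t))"
    using g(1) by (simp add: successively_append_iff last_map hd_map hd_rev)
  moreover have "distinct (gray (Suc t))" using g(2) by (auto simp: distinct_map)
  moreover have "gray (Suc t) \<noteq> []" using g(1) by simp
  ultimately show ?case unfolding is_path_iff_successively set_gray by blast
qed

section \<open>The value for the cube\<close>

lemma cube_colors_ge:
  assumes "t \<ge> 1" "finite (c ` cube_edges t)"
    and "distance_proper_connected (cube_verts t) (cube_edges t) l c"
  shows "min t (Suc l) \<le> card (c ` cube_edges t)"
proof -
  let ?u = "replicate t (0::nat)" and ?v = "replicate t (1::nat)"
  have "?u \<in> cube_verts t" "?v \<in> cube_verts t" "?u \<noteq> ?v"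
    using assms(1) by (auto simp: cube_verts_def)
  then obtain p where p: "is_path (cube_verts t) (cube_edges t) p" "hd p = ?u" "last p = ?v"
    "distance_proper l c p"
    using assms(3) unfolding distance_proper_connected_def by blast
  show ?thesis
    \<comment> \<open>Here \<open>m\<close> is \<open>min t (Suc l)\<close>: it is below
      \<open>length p\<close> because an antipodal path has more than \<open>t\<close>
      vertices.\<close>
    using card_colors_ge[OF assms(2) p(1,4)] cube_path_length[OF p(1-3)] by simp
qed

lemma pc1_cube:
  assumes "t \<ge> 1"
  shows "pc1 (cube_verts t) (cube_edges t) l = min t (Suc l)"
proof -
  obtain c where "distance_proper_connected (cube_verts t) (cube_edges t) l c"
    "c ` cube_edges t \<subseteq> {..<min t (Suc l)}"
  \<comment> \<open>Coloring by coordinate needs \<open>t\<close> colors and the cyclic Gray code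
    coloring \<open>Suc l\<close>; the cheaper one is taken.\<close>
  proof (cases "t \<le> Suc l")
    case True
    then show ?thesis
      using that[OF cube_dir_connected] cube_dir_less by (auto simp: min_absorb1)
  next
    case False
    then show ?thesis
      using that traceable_distance_proper_connected[OF is_path_gray set_gray]
      by (metis min.absorb2 nle_le)
  qed
  then show ?thesis using cube_colors_ge[OF assms] by (intro pc1_eqI)
qed

theorem theorem2p10:
  fixes t l :: nat
  assumes "t \<ge> 1" and "l \<ge> 2"
  shows "pc1 (cube_verts t) (cube_edges t) l =
           (if t = 1 then 1
            else if t = 2 then 2
            else if l \<ge> t then t
            else l + 1)"
  \<comment> \<open>For \<open>t \<le> 2\<close> the bound \<open>l \<ge> 2\<close> makes the
    minimum \<open>t\<close>; for \<open>l < t\<close> one has \<open>l + 1 \<le> t\<close>, so it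
    is \<open>l + 1\<close>.\<close>
  using assms by (auto simp: pc1_cube)

end
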